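(* The monoid $L_4^1 = \langle a,b,1 \mid aa=a,\ bb=b,\ abab=0\rangle$ is non-finitely based.
   Context: $L_4=\langle a,b\mid aa=a,\ bb=b,\ abab=0\rangle$ is the semigroup with zero $0$ generated by $a,b$ subject to the given relations, and $L_4^1$ is the (9-element) monoid obtained from $L_4$ by adjoining an identity element $1$. An identity is a formal equality of words over a countably infinite alphabet of variables. A semigroup (or monoid) is finitely based if there is a finite subset of its identities from which all of its identities can be deduced; otherwise it is non-finitely based. *)

theory Defs
  imports Main
begin

text \<open>
  The semigroup with zero presented by \<open>\<langle>a, b | aa = a, bb = b, abab = 0\<rangle>\<close>: nonempty words over
  \<open>a, b, 0\<close> modulo the least congruence containing the relations and the laws of a zero.
\<close>

datatype gen = GA | GB | GZ

inductive L4_eq :: "gen list \<Rightarrow> gen list \<Rightarrow> bool" where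
  rel_aa: "L4_eq [GA, GA] [GA]"
| rel_bb: "L4_eq [GB, GB] [GB]"
| rel_abab: "L4_eq [GA, GB, GA, GB] [GZ]"
| zero_left: "L4_eq [GZ, x] [GZ]"
| zero_right: "L4_eq [x, GZ] [GZ]"
| refl: "w \<noteq> [] \<Longrightarrow> L4_eq w w"
| sym: "L4_eq u v \<Longrightarrow> L4_eq v u"
| trans: "L4_eq u v \<Longrightarrow> L4_eq v w \<Longrightarrow> L4_eq u w"
| mult: "L4_eq u v \<Longrightarrow> L4_eq u' v' \<Longrightarrow> L4_eq (u @ u') (v @ v')"

quotient_type L4 = "gen list" / partial: L4_eq
proof (rule part_equivpI)
  show "\<exists>w. L4_eq w w"
    using L4_eq.refl by blast
  show "symp L4_eq"
    by (rule sympI) (rule L4_eq.sym)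
  show "transp L4_eq"
    by (rule transpI) (rule L4_eq.trans)
qed

instantiation L4 :: semigroup_mult
begin

lift_definition times_L4 :: "L4 \<Rightarrow> L4 \<Rightarrow> L4" is "(@)"
  by (rule L4_eq.mult)

instance
proof
  fix x y z :: L4
  show "x * y * z = x * (y * z)"
    by transfer (simp add: L4_eq.mult)
qed

end

datatype 'a adjoin_one = One | Elem 'a

instantiation adjoin_one :: (semigroup_mult) monoid_mult
begin

definition one_adjoin_one :: "'a adjoin_one" where
  "1 = One"

fun times_adjoin_one :: "'a adjoin_one \<Rightarrow> 'a adjoin_one \<Rightarrow> 'a adjoin_one" where
  "One * y = y"
| "x * One = x"
| "Elem s * Elem t = Elem (s * t)"

instance
proof
  fix x y z :: "'a adjoin_one"
  show "x * y * z = x * (y * z)"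
    by (cases x; cases y; cases z) (simp_all add: mult.assoc)
  show "1 * x = x" and "x * 1 = x"
    by (cases x; simp add: one_adjoin_one_def)+
qed

end

type_synonym L4_1 = "L4 adjoin_one"


text \<open>Variables are natural numbers.\<close>

type_synonym word = "nat list"
type_synonym identity = "word \<times> word"

text \<open>
  The parameter \<open>V\<close> is the set of admissible words: the free monoid \<open>UNIV\<close> for monoids, and the
  free semigroup \<open>{w. w \<noteq> []}\<close> for semigroups, where variables must not be erased.
\<close>

inductive deducible :: "word set \<Rightarrow> identity set \<Rightarrow> word \<Rightarrow> word \<Rightarrow> bool"
  for V :: "word set" and \<Sigma> :: "identity set" where
  hyp: "(u, v) \<in> \<Sigma> \<Longrightarrow> deducible V \<Sigma> u v"
| refl: "deducible V \<Sigma> w w"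
| sym: "deducible V \<Sigma> u v \<Longrightarrow> deducible V \<Sigma> v u"
| trans: "deducible V \<Sigma> u v \<Longrightarrow> deducible V \<Sigma> v w \<Longrightarrow> deducible V \<Sigma> u w"
| mult: "deducible V \<Sigma> u v \<Longrightarrow> deducible V \<Sigma> (p @ u @ q) (p @ v @ q)"
| subst: "deducible V \<Sigma> u v \<Longrightarrow> range \<theta> \<subseteq> V \<Longrightarrow>
    deducible V \<Sigma> (concat (map \<theta> u)) (concat (map \<theta> v))"

definition finitely_axiomatizable :: "word set \<Rightarrow> identity set \<Rightarrow> bool" where
  "finitely_axiomatizable V I \<longleftrightarrow>
    (\<exists>\<Sigma>. finite \<Sigma> \<and> \<Sigma> \<subseteq> I \<and> (\<forall>(u, v) \<in> I. deducible V \<Sigma> u v))"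


definition monoid_identities :: "'a::monoid_mult itself \<Rightarrow> identity set" where
  "monoid_identities _ =
    {(u, v). \<forall>\<phi> :: nat \<Rightarrow> 'a. prod_list (map \<phi> u) = prod_list (map \<phi> v)}"

definition finitely_based_monoid :: "'a::monoid_mult itself \<Rightarrow> bool" where
  "finitely_based_monoid M \<longleftrightarrow> finitely_axiomatizable UNIV (monoid_identities M)"


text \<open>The value on the empty word is unspecified and never used.\<close>

fun semigroup_eval :: "(nat \<Rightarrow> 'a::semigroup_mult) \<Rightarrow> word \<Rightarrow> 'a" where
  "semigroup_eval \<phi> [x] = \<phi> x"
| "semigroup_eval \<phi> (x # y # w) = \<phi> x * semigroup_eval \<phi> (y # w)"

definition semigroup_identities :: "'a::semigroup_mult itself \<Rightarrow> identity set" where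
  "semigroup_identities _ =
    {(u, v). u \<noteq> [] \<and> v \<noteq> [] \<and>
      (\<forall>\<phi> :: nat \<Rightarrow> 'a. semigroup_eval \<phi> u = semigroup_eval \<phi> v)}"

definition finitely_based_semigroup :: "'a::semigroup_mult itself \<Rightarrow> bool" where
  "finitely_based_semigroup S \<longleftrightarrow>
    finitely_axiomatizable {w. w \<noteq> []} (semigroup_identities S)"

end

theory Submission
  imports Defs "HOL-Library.Sublist"
begin

text \<open>
  Writing \<open>x\<close>, \<open>y\<close>, \<open>z\<^sub>1, \<dots>, z\<^sub>n\<close> for variables, \<open>L\<^sub>4\<^sup>1\<close> satisfies
  \<open>z\<^sub>n\<dots>z\<^sub>1 x x z\<^sub>1\<dots>z\<^sub>n y x y = z\<^sub>n\<dots>z\<^sub>1 x z\<^sub>1\<dots>z\<^sub>n x y x y\<close>: moving the \<open>x\<close> could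
  only matter when \<open>x\<close> takes one idempotent value while \<open>y\<close> and some \<open>z\<^sub>i\<close> take the other, and
  then both sides are zero.
  No consequence of shorter identities can insert an \<open>x\<close> between \<open>z\<^sub>n\<close> and \<open>y\<close>. Indeed, in a
  substitution instance of an identity of length less than \<open>n\<close>, some \<open>z\<^sub>i\<close> has its last occurrence
  either in the unchanged context or in the image of a variable \<open>v\<close> that occurs only once:
  otherwise the last occurrences of two of the \<open>z\<^sub>i\<close> lie in the image of the same letter, and this
  letter cannot be repeated because \<open>z\<^sub>n\<dots>z\<^sub>1\<close> and \<open>z\<^sub>1\<dots>z\<^sub>n\<close> list them in opposite orders. That occurrence can therefore be evaluated
  independently of the other occurrence of \<open>z\<^sub>i\<close>: sending \<open>x\<close> to \<open>b\<close>, the marked \<open>z\<^sub>i\<close> and \<open>y\<close> to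
  \<open>a\<close>, and everything else to \<open>1\<close>, gives \<open>baba\<close> if no \<open>x\<close> lies between the last \<open>z\<^sub>i\<close> and \<open>y\<close>,
  and zero otherwise.
\<close>

section \<open>Normal forms in the monoid\<close>

datatype nform = F1 | Fa | Fb | Fab | Fba | Faba | Fbab | Fbaba | F0

fun rep :: "nform \<Rightarrow> gen list" where
  "rep F1 = []"
| "rep Fa = [GA]"
| "rep Fb = [GB]"
| "rep Fab = [GA, GB]"
| "rep Fba = [GB, GA]"
| "rep Faba = [GA, GB, GA]"
| "rep Fbab = [GB, GA, GB]"
| "rep Fbaba = [GB, GA, GB, GA]"
| "rep F0 = [GZ]"

text \<open>Right multiplication by a generator. The catch-all clause covers \<open>GZ\<close>, the
  state \<open>F0\<close>, and the two steps that complete \<open>abab\<close>.\<close>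

fun push :: "nform \<Rightarrow> gen \<Rightarrow> nform" where
  "push F1 GA = Fa"
| "push F1 GB = Fb"
| "push Fa GA = Fa"
| "push Fa GB = Fab"
| "push Fb GA = Fba"
| "push Fb GB = Fb"
| "push Fab GA = Faba"
| "push Fab GB = Fab"
| "push Fba GA = Fba"
| "push Fba GB = Fbab"
| "push Faba GA = Faba"
| "push Fbab GA = Fbaba"
| "push Fbab GB = Fbab"
| "push Fbaba GA = Fbaba"
| "push _ _ = F0"

abbreviation pushes :: "nform \<Rightarrow> gen list \<Rightarrow> nform" where
  "pushes \<equiv> foldl push"

abbreviation nf :: "gen list \<Rightarrow> nform" where
  "nf \<equiv> pushes F1"

text \<open>The starting state is arbitrary because, in the product case, the second factor is read
  from the state that the first one reaches.\<close>

lemma pushes_L4_eq: "L4_eq u v \<Longrightarrow> pushes s u = pushes s v"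
proof (induction arbitrary: s rule: L4_eq.induct)
  case (zero_left x)
  then show ?case by (cases s; cases x) simp_all
next
  case (zero_right x)
  then show ?case by (cases s; cases x) simp_all
next
  case rel_aa
  show ?case by (cases s) simp_all
next
  case rel_bb
  show ?case by (cases s) simp_all
next
  case rel_abab
  show ?case by (cases s) simp_all
qed simp_all

text \<open>A word acts on every state as its normal form does. Hence equality of normal forms is
  also stable under left multiplication, which gives \<open>nf_cong\<close>.\<close>

lemma pushes_rep: "pushes s (rep (nf w)) = pushes s w"
proof (induction w rule: rev_induct)
  case (snoc g w)
  have "pushes s (rep (push t g)) = push (pushes s (rep t)) g" for t
    by (cases t; cases g; cases s) simp_all
  with snoc show ?case by simp
qed simp

lemma nf_cong: "nf u = nf v \<Longrightarrow> nf (p @ u @ q) = nf (p @ v @ q)"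
  using pushes_rep[of "nf p" u] pushes_rep[of "nf p" v] by simp

lemma L4_eq_snoc: "L4_eq u v \<Longrightarrow> L4_eq (u @ [g]) (v @ [g])"
  by (rule L4_eq.mult) (auto intro: L4_eq.refl)

lemma L4_eq_context: "L4_eq u v \<Longrightarrow> L4_eq (p @ u @ q) (p @ v @ q)"
proof -
  assume uv: "L4_eq u v"
  have "L4_eq (u @ q) (v @ q)"
    using uv by (cases "q = []") (auto intro: L4_eq.mult L4_eq.refl)
  then show ?thesis
    by (cases "p = []") (auto intro: L4_eq.mult L4_eq.refl)
qed

lemma L4_eq_absorb_zero: "L4_eq (GZ # w) [GZ]"
proof (induction w)
  case Nil
  show ?case by (simp add: L4_eq.refl)
next
  case (Cons g w)
  have "L4_eq ([] @ [GZ, g] @ w) ([] @ [GZ] @ w)"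
    by (intro L4_eq_context L4_eq.zero_left)
  with Cons show ?case by (auto intro: L4_eq.trans)
qed

text \<open>Each entry of the multiplication table follows from the presentation, so normal forms
  decide \<open>L4_eq\<close> on nonempty words.\<close>

lemma L4_eq_push:
  assumes "s \<noteq> F1"
  shows "L4_eq (rep s @ [g]) (rep (push s g))"
proof -
  have z: "L4_eq ([GA, GB, GA, GB] @ q) [GZ]" for q
    using L4_eq_context[OF L4_eq.rel_abab, of "[]" q] L4_eq_absorb_zero[of q]
    by (auto intro: L4_eq.trans)
  have z': "L4_eq ([GB, GA, GB, GA, GB]) [GZ]"
    using L4_eq_context[OF L4_eq.rel_abab, of "[GB]" "[]"] L4_eq.zero_right[of GB]
    by (auto intro: L4_eq.trans)
  have r: "L4_eq (p @ [GZ]) [GZ]" for p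
  proof (induction p)
    case (Cons h p)
    have "L4_eq ([h] @ (p @ [GZ]) @ []) ([h] @ [GZ] @ [])"
      by (intro L4_eq_context Cons)
    then show ?case using L4_eq.zero_right[of h] by (auto intro: L4_eq.trans)
  qed (simp add: L4_eq.refl)
  note a = L4_eq_context[OF L4_eq.rel_aa, of _ "[]", simplified]
  note b = L4_eq_context[OF L4_eq.rel_bb, of _ "[]", simplified]
  note facts = z[of "[]", simplified] z[of "[GA]", simplified] z' r[of "[GZ]", simplified]
    L4_eq.zero_left L4_eq.zero_right L4_eq.rel_aa L4_eq.rel_bb
    a[of "[GB]", simplified] b[of "[GA]", simplified] a[of "[GA, GB]", simplified]
    b[of "[GB, GA]", simplified] a[of "[GB, GA, GB]", simplified]
    r[of "[GA, GB]", simplified] r[of "[GB, GA]", simplified] r[of "[GA, GB, GA]", simplified]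
    r[of "[GB, GA, GB]", simplified] r[of "[GB, GA, GB, GA]", simplified]
  from assms show ?thesis
    by (cases s; cases g; simp add: facts L4_eq.refl)
qed

lemma L4_eq_rep_nf: "w \<noteq> [] \<Longrightarrow> L4_eq w (rep (nf w))"
proof (induction w rule: rev_nonempty_induct)
  case (single g)
  show ?case by (cases g) (simp_all add: L4_eq.refl)
next
  case (snoc g w)
  have "nf w \<noteq> F1"
  proof -
    have "push t h \<noteq> F1" for t h by (cases t; cases h) simp_all
    with snoc show ?thesis by (cases w rule: rev_cases) auto
  qed
  then show ?case
    using L4_eq_push L4_eq_snoc[OF snoc.IH] by (auto intro: L4_eq.trans)
qed

lemma nf_eq_F1_iff: "nf w = F1 \<longleftrightarrow> w = []"
proof -
  have "push t h \<noteq> F1" for t h by (cases t; cases h) simp_all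
  then show ?thesis by (cases w rule: rev_cases) auto
qed

lemma L4_eq_iff_nf: "u \<noteq> [] \<Longrightarrow> v \<noteq> [] \<Longrightarrow> L4_eq u v \<longleftrightarrow> nf u = nf v"
  by (metis L4_eq.sym L4_eq.trans L4_eq_rep_nf pushes_L4_eq)

section \<open>Identities of the monoid in terms of generator words\<close>

definition elem_of :: "gen list \<Rightarrow> L4_1" where
  "elem_of w = (if w = [] then One else Elem (abs_L4 w))"

lemma elem_of_eq_iff: "elem_of u = elem_of v \<longleftrightarrow> nf u = nf v"
proof (cases "u = [] \<or> v = []")
  case True
  then show ?thesis
    using nf_eq_F1_iff[of u] nf_eq_F1_iff[of v] by (auto simp: elem_of_def)
next
  case False
  then show ?thesis
    using L4_eq_iff_nf[of u v] Quotient3_rel[OF Quotient3_L4, of u v]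
    by (auto simp: elem_of_def L4_eq.refl)
qed

lemma elem_of_append: "elem_of (u @ v) = elem_of u * elem_of v"
  by (auto simp: elem_of_def times_L4.abs_eq L4_eq.refl)

lemma surj_elem_of: "\<exists>w. elem_of w = m"
proof (cases m)
  case One
  then show ?thesis by (auto simp: elem_of_def)
next
  case (Elem e)
  have "L4_eq (rep_L4 e) (rep_L4 e)"
    by (rule Quotient3_rep_reflp[OF Quotient3_L4])
  \<comment> \<open>\<open>L4_eq\<close> relates nonempty words only, so the representative of a
    class is nonempty and \<open>elem_of\<close> takes its second branch.\<close>
  moreover have "\<not> L4_eq [] []"
  proof -
    have "L4_eq u v \<Longrightarrow> u \<noteq> [] \<and> v \<noteq> []" for u v
      by (induction rule: L4_eq.induct) auto
    then show ?thesis by blast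
  qed
  ultimately have "rep_L4 e \<noteq> []" by metis
  then have "elem_of (rep_L4 e) = m"
    by (simp add: elem_of_def Elem Quotient3_abs_rep[OF Quotient3_L4])
  then show ?thesis ..
qed

abbreviation subst_word :: "('a \<Rightarrow> 'b list) \<Rightarrow> 'a list \<Rightarrow> 'b list" where
  "subst_word \<theta> w \<equiv> concat (map \<theta> w)"

lemma prod_list_elem_of: "prod_list (map (\<lambda>x. elem_of (\<phi> x)) w) = elem_of (subst_word \<phi> w)"
  by (induction w) (simp_all add: elem_of_append, simp add: elem_of_def one_adjoin_one_def)

definition equiv_L4_1 :: "word \<Rightarrow> word \<Rightarrow> bool" where
  "equiv_L4_1 u v \<longleftrightarrow> (\<forall>\<phi>. nf (subst_word \<phi> u) = nf (subst_word \<phi> v))"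

lemma mem_monoid_identities_iff:
  "(u, v) \<in> monoid_identities TYPE(L4_1) \<longleftrightarrow> equiv_L4_1 u v"
proof
  assume *: "(u, v) \<in> monoid_identities TYPE(L4_1)"
  show "equiv_L4_1 u v"
    unfolding equiv_L4_1_def
  proof
    fix \<phi> :: "nat \<Rightarrow> gen list"
    have "prod_list (map (\<lambda>x. elem_of (\<phi> x)) u) = prod_list (map (\<lambda>x. elem_of (\<phi> x)) v)"
      using * by (simp add: monoid_identities_def)
    then show "nf (subst_word \<phi> u) = nf (subst_word \<phi> v)"
      by (simp only: prod_list_elem_of elem_of_eq_iff)
  qed
next
  assume *: "equiv_L4_1 u v"
  have "prod_list (map \<phi> u) = prod_list (map \<phi> v)" for \<phi> :: "nat \<Rightarrow> L4_1"
  proof -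
    \<comment> \<open>Any assignment into the monoid lifts to generator words.\<close>
    have "\<exists>\<psi>. \<forall>x. elem_of (\<psi> x) = \<phi> x"
      by (intro choice allI surj_elem_of)
    then obtain \<psi> where "\<phi> = (\<lambda>x. elem_of (\<psi> x))" by (metis ext)
    then show ?thesis
      using * by (simp only: prod_list_elem_of elem_of_eq_iff equiv_L4_1_def)
  qed
  then show "(u, v) \<in> monoid_identities TYPE(L4_1)"
    by (simp add: monoid_identities_def)
qed

lemma semigroup_eval_prod_list:
  fixes \<phi> :: "nat \<Rightarrow> 'a::monoid_mult"
  shows "w \<noteq> [] \<Longrightarrow> semigroup_eval \<phi> w = prod_list (map \<phi> w)"
  by (induction \<phi> w rule: semigroup_eval.induct) simp_all

lemma mem_semigroup_identities_iff:
  "(u, v) \<in> semigroup_identities TYPE(L4_1) \<longleftrightarrow> u \<noteq> [] \<and> v \<noteq> [] \<and> equiv_L4_1 u v"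
  by (auto simp: semigroup_identities_def semigroup_eval_prod_list
      mem_monoid_identities_iff[symmetric] monoid_identities_def)

lemma subst_word_subst_word:
  "subst_word \<phi> (subst_word \<theta> w) = subst_word (\<lambda>x. subst_word \<phi> (\<theta> x)) w"
  by (induction w) auto

section \<open>Deduction as rewriting\<close>

text \<open>Here \<theta> may erase variables, so one relation serves both monoid and semigroup
  deduction.\<close>

inductive rewr :: "identity set \<Rightarrow> word \<Rightarrow> word \<Rightarrow> bool" for \<Sigma> where
  "(s, t) \<in> \<Sigma> \<or> (t, s) \<in> \<Sigma> \<Longrightarrow>
    rewr \<Sigma> (c @ subst_word \<theta> s @ d) (c @ subst_word \<theta> t @ d)"

lemma rewr_sym: "rewr \<Sigma> u v \<Longrightarrow> rewr \<Sigma> v u"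
  by (auto elim!: rewr.cases intro: rewr.intros)

lemma rewr_mult: "rewr \<Sigma> u v \<Longrightarrow> rewr \<Sigma> (p @ u @ q) (p @ v @ q)"
proof (elim rewr.cases)
  fix s t c \<theta> d
  assume "u = c @ subst_word \<theta> s @ d" "v = c @ subst_word \<theta> t @ d" "(s, t) \<in> \<Sigma> \<or> (t, s) \<in> \<Sigma>"
  then show ?thesis
    using rewr.intros[of s t \<Sigma> "p @ c" \<theta> "d @ q"] by simp
qed

lemma rewr_subst: "rewr \<Sigma> u v \<Longrightarrow> rewr \<Sigma> (subst_word \<theta> u) (subst_word \<theta> v)"
  by (auto elim!: rewr.cases simp: subst_word_subst_word intro: rewr.intros)

text \<open>Single steps are closed under reversal, contexts and substitution, so only transitivity
  lengthens a chain.\<close>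

lemma deducible_imp_rewr: "deducible V \<Sigma> u v \<Longrightarrow> (rewr \<Sigma>)\<^sup>*\<^sup>* u v"
proof (induction rule: deducible.induct)
  case (hyp u v)
  then have "rewr \<Sigma> ([] @ subst_word (\<lambda>x. [x]) u @ []) ([] @ subst_word (\<lambda>x. [x]) v @ [])"
    by (intro rewr.intros) simp
  moreover have "subst_word (\<lambda>x. [x]) w = w" for w :: word
    by (induction w) auto
  ultimately show ?case by auto
next
  case (sym u v)
  have "symp (rewr \<Sigma>)" by (auto intro: sympI rewr_sym)
  then show ?case using sym by (meson symp_rtranclp sympD)
next
  case (trans u v w)
  then show ?case by (meson rtranclp_trans)
next
  case (mult u v p q)
  from mult.IH show ?case
    by induction (auto elim!: rtranclp.rtrancl_into_rtrancl rewr_mult)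
next
  case (subst u v \<theta>)
  from subst.IH show ?case
    by induction (auto elim!: rtranclp.rtrancl_into_rtrancl rewr_subst)
qed simp

lemma rewr_equiv:
  assumes "rewr \<Sigma> u v" and "\<And>s t. (s, t) \<in> \<Sigma> \<Longrightarrow> equiv_L4_1 s t"
  shows "equiv_L4_1 u v"
  using assms(1)
proof cases
  case (1 s t c \<theta> d)
  then have "equiv_L4_1 s t"
    using assms(2) by (auto simp: equiv_L4_1_def)
  then show ?thesis
    unfolding 1 equiv_L4_1_def
    by (simp only: map_append concat_append subst_word_subst_word) (blast intro: nf_cong)
qed

section \<open>Nonzero words as words avoiding a subsequence\<close>

text \<open>The number of letters of \<open>abab\<close> that are matched greedily as a subsequence.\<close>

fun progress :: "nform \<Rightarrow> nat" where
  "progress F1 = 0"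
| "progress Fb = 0"
| "progress Fa = 1"
| "progress Fba = 1"
| "progress Fab = 2"
| "progress Fbab = 2"
| "progress Faba = 3"
| "progress Fbaba = 3"
| "progress F0 = 4"

text \<open>For the induction, the hypothesis speaks of the part of \<open>abab\<close> that the
  state \<open>s\<close> has not yet matched.\<close>

lemma pushes_eq_F0: "subseq (drop (progress s) [GA, GB, GA, GB]) v \<Longrightarrow> pushes s v = F0"
proof (induction v arbitrary: s)
  case Nil
  then show ?case by (cases s) simp_all
next
  case (Cons g v)
  have "subseq (drop (progress (push s g)) [GA, GB, GA, GB]) v"
    using Cons.prems by (cases s; cases g) (auto dest: subseq_Cons')
  then show ?case by (simp add: Cons.IH)
qed

lemma nf_eq_F0: "subseq [GA, GB, GA, GB] v \<Longrightarrow> nf v = F0"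
  by (rule pushes_eq_F0) simp

lemma subseq_snoc_mono: "subseq u v \<Longrightarrow> subseq u' (u @ [g]) \<Longrightarrow> subseq u' (v @ [g])"
  by (meson subseq_append' subseq_order.order_trans subseq_append)

text \<open>Without \<open>GZ\<close>, the state \<open>F0\<close> is entered only by completing
  \<open>abab\<close>, which therefore replaces \<open>rep F0\<close> as the witness.\<close>

lemma subseq_nf:
  "GZ \<notin> set v \<Longrightarrow> subseq (if nf v = F0 then [GA, GB, GA, GB] else rep (nf v)) v"
proof (induction v rule: rev_induct)
  case (snoc g v)
  let ?f = "\<lambda>s. if s = F0 then [GA, GB, GA, GB] else rep s"
  have "g \<noteq> GZ" using snoc.prems by auto
  then have "subseq (?f (push s g)) (?f s @ [g])" for s
    by (cases s; cases g) simp_all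
  moreover have "subseq (?f (nf v)) v"
    using snoc by simp
  ultimately have "subseq (?f (push (nf v) g)) (v @ [g])"
    by (blast intro: subseq_snoc_mono)
  then show ?case by (simp only: foldl_append foldl_Cons foldl_Nil)
qed simp

lemma subseq_set_subset: "subseq u v \<Longrightarrow> set u \<subseteq> set v"
  by (induction rule: list_emb.induct) auto

lemma subseq_subst_word: "subseq u w \<Longrightarrow> subseq (subst_word \<phi> u) (subst_word \<phi> w)"
  by (induction rule: list_emb.induct) (auto intro: list_emb_append2 list_emb_append_mono)

text \<open>Each variable contributes at most one letter, so an embedding pulls back letter by
  letter.\<close>

lemma subseq_subst_wordE:
  assumes "\<And>x. length (\<phi> x) \<le> 1" and "subseq us (subst_word \<phi> w)"
  obtains vs where "subseq vs w" "map \<phi> vs = map (\<lambda>g. [g]) us"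
proof -
  have "\<exists>vs. subseq vs w \<and> map \<phi> vs = map (\<lambda>g. [g]) us"
    using assms(2)
  proof (induction w arbitrary: us)
    case (Cons x w)
    show ?case
    proof (cases "\<phi> x")
      case Nil
      with Cons.prems have "subseq us (subst_word \<phi> w)" by simp
      with Cons.IH show ?thesis by (meson list_emb_Cons)
    next
      case (Cons g l)
      with assms(1)[of x] have x: "\<phi> x = [g]" by simp
      show ?thesis
      proof (cases "\<exists>us'. us = g # us' \<and> subseq us' (subst_word \<phi> w)")
        case True
        then obtain us' where us: "us = g # us'" "subseq us' (subst_word \<phi> w)" by blast
        from Cons.IH[OF us(2)] obtain vs where "subseq vs w" "map \<phi> vs = map (\<lambda>g. [g]) us'" by blast
        then have "subseq (x # vs) (x # w) \<and> map \<phi> (x # vs) = map (\<lambda>g. [g]) us"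
          using x us by simp
        then show ?thesis by blast
      next
        case False
        have "subseq us (g # subst_word \<phi> w)" using Cons.prems x by simp
        with False have "subseq us (subst_word \<phi> w)" by (cases us) (auto split: if_splits)
        with Cons.IH show ?thesis by (meson list_emb_Cons)
      qed
    qed
  next
    case Nil
    then have "us = []" by (cases us) auto
    then show ?case by auto
  qed
  with that show ?thesis by blast
qed

section \<open>The separating identities\<close>

text \<open>The variables \<open>0\<close> and \<open>1\<close> play the roles of \<open>x\<close> and \<open>y\<close>; the \<open>z\<^sub>i\<close> are the variables from \<open>2\<close> on.\<close>

definition letters :: "nat \<Rightarrow> word" where
  "letters n = [2..<n + 2]"

definition lhs :: "nat \<Rightarrow> word" where
  "lhs n = rev (letters n) @ [0, 0] @ letters n @ [1, 0, 1]"

definition rhs :: "nat \<Rightarrow> word" where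
  "rhs n = rev (letters n) @ [0] @ letters n @ [0, 1, 0, 1]"

text \<open>A finite check: \<open>p\<close> and \<open>q\<close> are the values of the two blocks
  of z-variables, which have the same content unless one of them is zero; \<open>x\<close> and
  \<open>r\<close> are the values of x and y.\<close>

lemma pushes_same_content:
  assumes "p = F0 \<or> q = F0 \<or> (\<forall>g. g \<in> set (rep p) \<longleftrightarrow> g \<in> set (rep q))"
  shows "nf (rep p @ rep x @ rep x @ rep q @ rep r @ rep x @ rep r) =
    nf (rep p @ rep x @ rep q @ rep x @ rep r @ rep x @ rep r)"
proof -
  have "p = F0 \<or> q = F0 \<or> (GA \<in> set (rep p) \<longleftrightarrow> GA \<in> set (rep q)) \<and> (GB \<in> set (rep p) \<longleftrightarrow> GB \<in> set (rep q))"
    using assms by blast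
  then show ?thesis
    by (cases p; cases q; simp; cases x; simp; cases r; simp)
qed

lemma set_rep_nf: "nf w \<noteq> F0 \<Longrightarrow> set (rep (nf w)) = set w"
proof (induction w rule: rev_induct)
  case (snoc g w)
  have "s \<noteq> F0 \<and> set (rep (push s g)) = insert g (set (rep s))" if "push s g \<noteq> F0" for s
    using that by (cases s; cases g) auto
  with snoc show ?case by simp
qed simp

lemma equiv_lhs_rhs: "equiv_L4_1 (lhs n) (rhs n)"
  unfolding equiv_L4_1_def
proof
  fix \<phi> :: "nat \<Rightarrow> gen list"
  let ?p = "subst_word \<phi> (rev (letters n))" and ?q = "subst_word \<phi> (letters n)"
  have "set ?p = set ?q" by simp
  then have c: "nf ?p = F0 \<or> nf ?q = F0 \<or>
      (\<forall>g. g \<in> set (rep (nf ?p)) \<longleftrightarrow> g \<in> set (rep (nf ?q)))"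
    using set_rep_nf[of ?p] set_rep_nf[of ?q] by blast
  show "nf (subst_word \<phi> (lhs n)) = nf (subst_word \<phi> (rhs n))"
    using pushes_same_content[OF c, of "nf (\<phi> 0)" "nf (\<phi> 1)"]
    by (simp add: lhs_def rhs_def pushes_rep)
qed

lemma pushes_replicate: "0 < k \<Longrightarrow> pushes s (replicate k g) = push s g"
proof -
  have "push (push s g) g = push s g" by (cases s; cases g) simp_all
  then have "pushes (push s g) (replicate j g) = push s g" for j
    by (induction j) simp_all
  then show "0 < k \<Longrightarrow> ?thesis" by (cases k) simp_all
qed

lemma subst_word_replicate:
  "(\<And>x. x \<in> set xs \<Longrightarrow> \<phi> x = [g]) \<Longrightarrow> subst_word \<phi> xs = replicate (length xs) g"
  by (induction xs) auto

lemma subst_word_empty: "(\<And>x. x \<in> set xs \<Longrightarrow> \<phi> x = []) \<Longrightarrow> subst_word \<phi> xs = []"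
  by (induction xs) auto

lemma letters_split:
  assumes "i \<in> set (letters n)"
  obtains xs ys where "letters n = xs @ i # ys" "i \<notin> set xs" "i \<notin> set ys"
    "i \<noteq> 0" "i \<noteq> 1" "0 \<notin> set xs" "0 \<notin> set ys"
proof -
  from assms obtain xs ys where e: "letters n = xs @ i # ys" by (meson split_list)
  have "distinct (letters n)" "0 \<notin> set (letters n)" "1 \<notin> set (letters n)"
    by (auto simp: letters_def)
  with e that show ?thesis by auto
qed

text \<open>Send \<open>y\<close> to ab and erase the rest: one occurrence gives ab, none gives the
  identity, and two or more give zero.\<close>

lemma equiv_occurs_once:
  assumes eq: "equiv_L4_1 (s1 @ y # s2) t" and "y \<notin> set s1" "y \<notin> set s2"
  obtains t1 t2 where "t = t1 @ y # t2" "y \<notin> set t1" "y \<notin> set t2"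
proof -
  define \<phi> where "\<phi> = (\<lambda>_. [])(y := [GA, GB])"
  have e: "subst_word \<phi> xs = []" if "y \<notin> set xs" for xs
    using that by (intro subst_word_empty) (auto simp: \<phi>_def)
  have "nf (subst_word \<phi> (s1 @ y # s2)) = Fab"
    using assms by (simp add: e) (simp add: \<phi>_def)
  then have t: "nf (subst_word \<phi> t) = Fab"
    using eq by (simp add: equiv_L4_1_def)
  have "y \<in> set t"
  proof (rule ccontr)
    assume "y \<notin> set t"
    then have "nf (subst_word \<phi> t) = F1" by (subst e) simp_all
    with t show False by (simp only: nform.distinct)
  qed
  then obtain t1 t2 where t12: "t = t1 @ y # t2" "y \<notin> set t1" by (meson split_list_first)
  have "y \<notin> set t2"
  proof
    assume "y \<in> set t2"
    then obtain u v where "t2 = u @ y # v" by (meson split_list)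
    then have "subseq ([y] @ [y]) ((t1 @ [y]) @ u @ y # v)"
      by (intro list_emb_append_mono) auto
    then have "subseq [y, y] t" using t12 \<open>t2 = u @ y # v\<close> by simp
    from subseq_subst_word[OF this, of \<phi>] have "nf (subst_word \<phi> t) = F0"
      by (intro nf_eq_F0) (simp add: \<phi>_def)
    with t show False by simp
  qed
  with t12 that show ?thesis by blast
qed

text \<open>The z-variables vanish, so that a letter \<open>GA\<close> put in by hand can stand for
  one marked occurrence independently of the others.\<close>

definition erase :: "nat \<Rightarrow> gen list" where
  "erase x = (if x = 0 then [GB] else if x = 1 then [GA] else [])"

text \<open>
  In words equivalent to \<open>lhs n\<close>, this says that some \<open>x\<close> lies between the last \<open>z\<^sub>i\<close> and the first \<open>y\<close>.
\<close>

definition has_insertion :: "nat \<Rightarrow> word \<Rightarrow> bool" where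
  "has_insertion n w \<longleftrightarrow>
    (\<exists>w1 w2. w = w1 @ 0 # w2 \<and> (\<forall>i \<in> set (letters n). i \<notin> set w2) \<and> subseq [1, 0] w2)"

text \<open>Since \<open>i\<close> avoids \<open>w2\<close>, the marked occurrence precedes the
  \<open>0\<close> before \<open>w2\<close>; the mark, this \<open>0\<close> and
  \<open>[1, 0]\<close> spell abab. Any occurrence of \<open>i\<close> may be marked.\<close>

lemma has_insertion_imp_erase_eq_F0:
  assumes "has_insertion n w" and "i \<in> set (letters n)" and "w = u @ i # v"
  shows "nf (subst_word erase u @ GA # subst_word erase v) = F0"
proof -
  obtain w1 w2 where w: "w = w1 @ 0 # w2" "i \<notin> set w2" "subseq [1, 0] w2"
    using assms by (auto simp: has_insertion_def)
  have "i \<noteq> 0" using assms by (auto simp: letters_def)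
  with w assms(3) obtain v1 where v: "v = v1 @ 0 # w2"
    by (auto simp: append_eq_append_conv2 Cons_eq_append_conv append_eq_Cons_conv)
  have "subseq [GA, GB] (subst_word erase w2)"
    using subseq_subst_word[OF w(3), of erase] by (simp add: erase_def)
  then have "subseq ([GA] @ [GB, GA, GB])
      ((subst_word erase u @ [GA]) @ subst_word erase v1 @ GB # subst_word erase w2)"
    by (intro list_emb_append_mono list_emb_append2) auto
  then show ?thesis
    by (intro nf_eq_F0) (simp add: v erase_def)
qed

section \<open>Subsequences of words equivalent to \<open>lhs n\<close>\<close>

context
  fixes n :: nat and w :: word
  assumes n: "0 < n" and eq: "equiv_L4_1 (lhs n) w"
begin

text \<open>Send \<open>i\<close> to a, \<open>k\<close> to b and erase the rest. The two blocks
  list \<open>i\<close> and \<open>k\<close> in opposite orders, so \<open>lhs n\<close> becomes aba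
  or bab, which is nonzero.\<close>

lemma no_ikik:
  assumes "i \<in> set (letters n)" "k \<in> set (letters n)" "i \<noteq> k"
  shows "\<not> subseq [i, k, i, k] w"
proof
  assume *: "subseq [i, k, i, k] w"
  define \<phi> where "\<phi> = (\<lambda>_. [])(i := [GA], k := [GB])"
  have e: "subst_word \<phi> xs = []" if "i \<notin> set xs" "k \<notin> set xs" for xs
    using that by (intro subst_word_empty) (auto simp: \<phi>_def)
  have \<phi>: "\<phi> i = [GA]" "\<phi> k = [GB]" "\<phi> 0 = []" "\<phi> 1 = []"
    using assms by (auto simp: \<phi>_def letters_def)
  obtain xs ys where l: "letters n = xs @ i # ys" "i \<notin> set xs" "i \<notin> set ys"
    using letters_split[OF assms(1)] by metis
  have d: "distinct (letters n)" by (simp add: letters_def)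
  have "k \<in> set xs \<or> k \<in> set ys" using assms l by auto
  then have "nf (subst_word \<phi> (lhs n)) \<noteq> F0"
  proof
    assume "k \<in> set xs"
    then obtain us vs where "xs = us @ k # vs" by (meson split_list)
    then show ?thesis
      using l d by (simp add: lhs_def \<phi> e del: One_nat_def)
  next
    assume "k \<in> set ys"
    then obtain us vs where "ys = us @ k # vs" by (meson split_list)
    then show ?thesis
      using l d by (simp add: lhs_def \<phi> e del: One_nat_def)
  qed
  moreover have "nf (subst_word \<phi> w) = F0"
    using subseq_subst_word[OF *, of \<phi>] by (intro nf_eq_F0) (simp add: \<phi>)
  ultimately show False using eq by (simp add: equiv_L4_1_def)
qed

text \<open>Send \<open>i\<close> to b, \<open>0\<close> to a and erase the rest:
  \<open>lhs n\<close> has the nonzero value baba, which \<open>subseq_nf\<close> turns back into a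
  subsequence.\<close>

lemma has_i0i0:
  assumes "i \<in> set (letters n)"
  shows "subseq [i, 0, i, 0] w"
proof -
  define \<phi> where "\<phi> = (\<lambda>_. [])(i := [GB], 0 := [GA])"
  obtain xs ys where l: "letters n = xs @ i # ys" "i \<notin> set xs" "i \<notin> set ys"
    "i \<noteq> 0" "i \<noteq> 1" "0 \<notin> set xs" "0 \<notin> set ys"
    using letters_split[OF assms] by metis
  have e: "subst_word \<phi> xs = []" if "i \<notin> set xs" "0 \<notin> set xs" for xs
    using that by (intro subst_word_empty) (auto simp: \<phi>_def intro: gr0I)
  have \<phi>: "\<phi> i = [GB]" "\<phi> 0 = [GA]" "\<phi> 1 = []"
    using l by (auto simp: \<phi>_def)
  have "nf (subst_word \<phi> (lhs n)) = Fbaba"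
    using l by (simp add: lhs_def \<phi> e del: One_nat_def)
  then have "nf (subst_word \<phi> w) = Fbaba" using eq by (simp add: equiv_L4_1_def)
  moreover have "GZ \<notin> set (subst_word \<phi> w)" by (auto simp: \<phi>_def split: if_splits)
  ultimately have "subseq [GB, GA, GB, GA] (subst_word \<phi> w)"
    using subseq_nf[of "subst_word \<phi> w"] by simp
  moreover have "length (\<phi> x) \<le> 1" for x by (simp add: \<phi>_def)
  ultimately obtain vs where "subseq vs w" "map \<phi> vs = map (\<lambda>g. [g]) [GB, GA, GB, GA]"
    using subseq_subst_wordE by metis
  moreover from this(2) have "vs = [i, 0, i, 0]"
    by (auto simp: \<phi>_def map_eq_Cons_conv split: if_splits)
  ultimately show ?thesis by simp
qed

text \<open>With all z-variables sent to b and \<open>0\<close> to a, \<open>lhs n\<close> becomes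
  baba, whereas a further b would give zero.\<close>

lemma no_i0i0k:
  assumes "i \<in> set (letters n)" "k \<in> set (letters n)"
  shows "\<not> subseq [i, 0, i, 0, k] w"
proof
  assume *: "subseq [i, 0, i, 0, k] w"
  define \<phi> :: "nat \<Rightarrow> gen list" where
    "\<phi> = (\<lambda>x. if x = 0 then [GA] else if x = 1 then [] else [GB])"
  have \<phi>: "\<phi> i = [GB]" "\<phi> k = [GB]" "\<phi> 0 = [GA]" "\<phi> 1 = []"
    using assms by (auto simp: \<phi>_def letters_def)
  have "subst_word \<phi> (letters n) = replicate n GB"
    "subst_word \<phi> (rev (letters n)) = replicate n GB"
    by (subst subst_word_replicate[where g = GB]; auto simp: letters_def \<phi>_def)+
  then have "nf (subst_word \<phi> (lhs n)) = Fbaba"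
    using n by (simp add: lhs_def pushes_replicate \<phi> del: One_nat_def)
  moreover have "nf (subst_word \<phi> w) = F0"
    using subseq_subst_word[OF *, of \<phi>]
      subseq_Cons'[of GB "[GA, GB, GA, GB]" "subst_word \<phi> w"]
    by (intro nf_eq_F0) (simp add: \<phi>)
  ultimately show False using eq by (simp add: equiv_L4_1_def)
qed

text \<open>With \<open>1\<close> sent to a and the z-variables to b, \<open>lhs n\<close> becomes
  ba. The left factor ab makes this aba, but turns an occurrence of \<open>[1, i]\<close> into
  abab.\<close>

lemma no_1i:
  assumes "i \<in> set (letters n)"
  shows "\<not> subseq [1, i] w"
proof
  assume *: "subseq [1, i] w"
  define \<phi> :: "nat \<Rightarrow> gen list" where
    "\<phi> = (\<lambda>x. if x = 0 then [] else if x = 1 then [GA] else [GB])"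
  have \<phi>: "\<phi> i = [GB]" "\<phi> 0 = []" "\<phi> 1 = [GA]"
    using assms by (auto simp: \<phi>_def letters_def)
  have "subst_word \<phi> (letters n) = replicate n GB"
    "subst_word \<phi> (rev (letters n)) = replicate n GB"
    by (subst subst_word_replicate[where g = GB]; auto simp: letters_def \<phi>_def)+
  then have "nf ([GA, GB] @ subst_word \<phi> (lhs n) @ []) = Faba"
    using n by (simp add: lhs_def pushes_replicate \<phi> del: One_nat_def)
  moreover have "nf ([GA, GB] @ subst_word \<phi> w @ []) = F0"
    using subseq_subst_word[OF *, of \<phi>]
    by (intro nf_eq_F0) (auto simp: \<phi> simp del: One_nat_def)
  moreover have "nf ([GA, GB] @ subst_word \<phi> (lhs n) @ []) = nf ([GA, GB] @ subst_word \<phi> w @ [])"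
    using eq by (intro nf_cong) (simp add: equiv_L4_1_def)
  ultimately show False by simp
qed

text \<open>Converse of \<open>has_insertion_imp_erase_eq_F0\<close>, for the last occurrence of
  \<open>i\<close>: no \<open>1\<close> precedes the mark, so abab must start at the mark and
  \<open>v\<close> contains \<open>[0, 1, 0]\<close>.\<close>

lemma erase_eq_F0_imp_has_insertion:
  assumes w: "w = u @ i # v" and i: "i \<in> set (letters n)" "i \<notin> set v"
    and zero: "nf (subst_word erase u @ GA # subst_word erase v) = F0"
  shows "has_insertion n w"
proof -
  have "1 \<notin> set u"
  proof
    assume "1 \<in> set u"
    then have "subseq ([1] @ [i]) (u @ i # v)"
      by (intro list_emb_append_mono) (auto simp: subseq_singleton_left simp del: One_nat_def)
    with no_1i[OF i(1)] w show False by simp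
  qed
  then have A: "GA \<notin> set (subst_word erase u)"
    by (auto simp: erase_def split: if_splits)
  have "GZ \<notin> set (subst_word erase u @ GA # subst_word erase v)"
    by (auto simp: erase_def split: if_splits)
  then have "subseq [GA, GB, GA, GB] (subst_word erase u @ GA # subst_word erase v)"
    using subseq_nf zero by metis
  then obtain p q where pq: "[GA, GB, GA, GB] = p @ q" "subseq p (subst_word erase u)"
      "subseq q (GA # subst_word erase v)"
    by (meson subseq_appendE)
  have "p = []"
    using pq(1) A subseq_set_subset[OF pq(2)] by (cases p) auto
  with pq(1,3) have "subseq [GB, GA, GB] (subst_word erase v)" by auto
  moreover have "length (erase x) \<le> 1" for x by (simp add: erase_def)
  ultimately obtain vs where vs: "subseq vs v" "map erase vs = map (\<lambda>g. [g]) [GB, GA, GB]"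
    using subseq_subst_wordE by metis
  from vs(2) have "vs = [0, 1, 0]"
    by (auto simp: erase_def map_eq_Cons_conv split: if_splits)
  with vs(1) obtain v1 v2 where v: "v = v1 @ 0 # v2" "subseq [1, 0] v2"
    by (auto dest: list_emb_ConsD)
  have "subseq [i, 0, i, 0] (u @ i # v)"
    using has_i0i0[OF i(1)] w by simp
  then obtain p q where pq: "[i, 0, i, 0] = p @ q" "subseq p u" "subseq q (i # v)"
    by (meson subseq_appendE)
  \<comment> \<open>The second \<open>i\<close> of \<open>[i, 0, i, 0]\<close> lies no later than
    the marked one, as \<open>v\<close> is free of \<open>i\<close>.\<close>
  have i0: "subseq [i, 0] u"
  proof (cases "\<exists>p'. p = [i, 0] @ p'")
    case True
    then have "subseq [i, 0] p" by auto
    with pq(2) show ?thesis by (meson subseq_order.order_trans)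
  next
    case False
    with pq(1) have "p = [] \<or> p = [i]"
      by (auto simp: Cons_eq_append_conv)
    moreover have "\<not> subseq xs v" if "i \<in> set xs" for xs
      using that i(2) subseq_set_subset by fastforce
    ultimately show ?thesis using pq by (auto split: if_splits)
  qed
  \<comment> \<open>Otherwise \<open>[i, 0]\<close> in \<open>u\<close>, the mark, the
    \<open>0\<close> after \<open>v1\<close> and \<open>k\<close> form the subsequence forbidden by
    \<open>no_i0i0k\<close>.\<close>
  have "k \<notin> set v2" if k: "k \<in> set (letters n)" for k
  proof
    assume "k \<in> set v2"
    then have "subseq ([i, 0] @ [i] @ [0] @ [k]) (u @ (i # v1) @ [0] @ v2)"
      using i0 by (intro list_emb_append_mono) (auto simp: subseq_singleton_left)
    with no_i0i0k[OF i(1) k] show False by (simp add: w v)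
  qed
  with v w show ?thesis
    unfolding has_insertion_def by (metis append.assoc append_Cons)
qed

text \<open>The marked occurrence is the last \<open>i\<close> of \<open>w\<close> and survives the
  replacement; the two values agree because they arise from \<open>s\<close> and \<open>t\<close>
  under one assignment, inside one context.\<close>

lemma mark_occurrence:
  assumes w: "w = c @ subst_word \<theta> s @ d" and st: "equiv_L4_1 s t" and "length s < n"
  obtains i u v u' v' where "i \<in> set (letters n)" "w = u @ i # v" "i \<notin> set v"
    "c @ subst_word \<theta> t @ d = u' @ i # v'"
    "nf (subst_word erase u @ GA # subst_word erase v) =
      nf (subst_word erase u' @ GA # subst_word erase v')"
proof -
  have erase_eq: "nf (subst_word erase (subst_word \<theta> s)) = nf (subst_word erase (subst_word \<theta> t))"
    using st by (simp only: equiv_L4_1_def subst_word_subst_word)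
  consider (frame_right) i where "i \<in> set (letters n)" "i \<in> set d"
    | (frame_left) i where "i \<in> set (letters n)" "i \<notin> set d" "i \<notin> set (subst_word \<theta> s)"
    | (inner) "\<forall>i \<in> set (letters n). i \<notin> set d \<and> i \<in> set (subst_word \<theta> s)"
    by blast
  then show ?thesis
  proof cases
    case frame_right
    then obtain d1 d2 where d: "d = d1 @ i # d2" "i \<notin> set d2"
      by (meson split_list_last)
    show ?thesis
    proof (rule that)
      show "i \<in> set (letters n)" "i \<notin> set d2" by fact+
      show "w = (c @ subst_word \<theta> s @ d1) @ i # d2"
        "c @ subst_word \<theta> t @ d = (c @ subst_word \<theta> t @ d1) @ i # d2"
        by (simp_all add: w d)
      show "nf (subst_word erase (c @ subst_word \<theta> s @ d1) @ GA # subst_word erase d2) =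
          nf (subst_word erase (c @ subst_word \<theta> t @ d1) @ GA # subst_word erase d2)"
        using nf_cong[OF erase_eq, of "subst_word erase c"
            "subst_word erase d1 @ GA # subst_word erase d2"] by simp
    qed
  next
    case frame_left
    have "i \<in> set w"
      using subseq_set_subset[OF has_i0i0[OF frame_left(1)]] by simp
    with frame_left have "i \<in> set c" by (auto simp: w)
    then obtain c1 c2 where c: "c = c1 @ i # c2" "i \<notin> set c2"
      by (meson split_list_last)
    show ?thesis
    proof (rule that)
      show "i \<in> set (letters n)" by fact
      show "i \<notin> set (c2 @ subst_word \<theta> s @ d)"
        using c frame_left by simp
      show "w = c1 @ i # (c2 @ subst_word \<theta> s @ d)"
        "c @ subst_word \<theta> t @ d = c1 @ i # (c2 @ subst_word \<theta> t @ d)"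
        by (simp_all add: w c)
      show "nf (subst_word erase c1 @ GA # subst_word erase (c2 @ subst_word \<theta> s @ d)) =
          nf (subst_word erase c1 @ GA # subst_word erase (c2 @ subst_word \<theta> t @ d))"
        using nf_cong[OF erase_eq, of "subst_word erase c1 @ GA # subst_word erase c2"
            "subst_word erase d"] by simp
    qed
  next
    case inner
    \<comment> \<open>The letter \<open>y\<close> is the last one of \<open>s\<close> whose image
      contains \<open>i\<close>; the length of \<open>s1\<close> records its position.\<close>
    have "\<exists>s1 y s2. s = s1 @ y # s2 \<and> i \<in> set (\<theta> y) \<and> i \<notin> set (subst_word \<theta> s2)"
      if "i \<in> set (letters n)" for i
    proof -
      have "\<exists>y \<in> set s. i \<in> set (\<theta> y)" using inner that by auto
      from split_list_last_prop[OF this] show ?thesis by auto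
    qed
    then obtain s1 y s2 where s12: "\<And>i. i \<in> set (letters n) \<Longrightarrow>
        s = s1 i @ y i # s2 i \<and> i \<in> set (\<theta> (y i)) \<and> i \<notin> set (subst_word \<theta> (s2 i))"
      by metis
    have "(\<lambda>i. length (s1 i)) ` set (letters n) \<subseteq> {..<length s}"
    proof
      fix j assume "j \<in> (\<lambda>i. length (s1 i)) ` set (letters n)"
      then obtain i where i: "i \<in> set (letters n)" "j = length (s1 i)" by blast
      have "length s = length (s1 i @ y i # s2 i)" using s12[OF i(1)] by metis
      then show "j \<in> {..<length s}" by (simp add: i)
    qed
    then have "card ((\<lambda>i. length (s1 i)) ` set (letters n)) \<le> length s"
      using card_mono[OF finite_lessThan] by force
    also have "\<dots> < card (set (letters n))"
      using \<open>length s < n\<close> by (simp add: letters_def distinct_card del: upt_Suc set_upt)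
    finally have "card ((\<lambda>i. length (s1 i)) ` set (letters n)) < card (set (letters n))" .
    \<comment> \<open>There are fewer positions in \<open>s\<close> than z-variables, so two of
      these share a position.\<close>
    then obtain i k where ik: "i \<in> set (letters n)" "k \<in> set (letters n)" "i \<noteq> k"
        "length (s1 i) = length (s1 k)"
      using pigeonhole by (meson inj_onI)
    have yk: "y k = y i"
      using s12[OF ik(1)] s12[OF ik(2)] ik(4) by (metis append_eq_append_conv list.inject)
    have s: "s = s1 i @ y i # s2 i" and "i \<in> set (\<theta> (y i))" "k \<in> set (\<theta> (y i))"
      and i2: "i \<notin> set (subst_word \<theta> (s2 i))"
      using s12[OF ik(1)] s12[OF ik(2)] yk by simp_all
    then obtain z1 z2 where z: "\<theta> (y i) = z1 @ i # z2" "i \<notin> set z2"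
      by (meson split_list_last)
    have y2: "y i \<notin> set (s2 i)"
      using i2 \<open>i \<in> set (\<theta> (y i))\<close> by auto
    have y1: "y i \<notin> set (s1 i)"
    proof
      assume "y i \<in> set (s1 i)"
      then obtain a b where ab: "s1 i = a @ y i # b" by (meson split_list)
      \<comment> \<open>A repeated letter would duplicate every subsequence of its image, including
        \<open>[i, k]\<close> or \<open>[k, i]\<close>.\<close>
      have rep: "subseq (xs @ xs) w" if "subseq xs (\<theta> (y i))" for xs
      proof -
        have "subseq (xs @ xs) ((c @ subst_word \<theta> a @ \<theta> (y i)) @
            subst_word \<theta> b @ \<theta> (y i) @ subst_word \<theta> (s2 i) @ d)"
          using that by (intro list_emb_append_mono) (auto intro: list_emb_prefix)
        moreover have "w = (c @ subst_word \<theta> a @ \<theta> (y i)) @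
            subst_word \<theta> b @ \<theta> (y i) @ subst_word \<theta> (s2 i) @ d"
          unfolding w by (subst s, subst ab) simp
        ultimately show ?thesis by simp
      qed
      have "k \<in> set z1 \<or> k \<in> set z2"
        using z \<open>k \<in> set (\<theta> (y i))\<close> ik(3) by auto
      then show False
      proof
        assume "k \<in> set z1"
        then have "subseq ([k] @ [i]) (\<theta> (y i))"
          unfolding z by (intro list_emb_append_mono) (auto simp: subseq_singleton_left)
        from rep[OF this] no_ikik[OF ik(2,1)] ik(3) show False by auto
      next
        assume "k \<in> set z2"
        then have "subseq [i, k] (\<theta> (y i))"
          unfolding z by (intro list_emb_append2) (auto simp: subseq_singleton_left)
        from rep[OF this] no_ikik[OF ik(1,2)] ik(3) show False by auto
      qed
    qed
    obtain t1 t2 where t: "t = t1 @ y i # t2" "y i \<notin> set t1" "y i \<notin> set t2"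
      using equiv_occurs_once[of "s1 i" "y i" "s2 i" t] st s y1 y2 by metis
    \<comment> \<open>This is \<open>erase\<close> after \<theta>, except that the last
      \<open>i\<close> in the image of \<open>y i\<close> becomes \<open>GA\<close>. As
      \<open>y i\<close> occurs once in \<open>s\<close> and once in \<open>t\<close>, exactly one
      occurrence is marked on each side.\<close>
    define \<psi> where "\<psi> = (\<lambda>x. subst_word erase (\<theta> x))
      (y i := subst_word erase z1 @ GA # subst_word erase z2)"
    have \<psi>: "subst_word \<psi> xs = subst_word erase (subst_word \<theta> xs)" if "y i \<notin> set xs" for xs
      unfolding subst_word_subst_word using that
      by (intro arg_cong[where f = concat] map_cong) (auto simp: \<psi>_def)
    have \<psi>y: "\<psi> (y i) = subst_word erase z1 @ GA # subst_word erase z2"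
      by (simp add: \<psi>_def)
    have \<psi>_eq: "nf (subst_word \<psi> s) = nf (subst_word \<psi> t)"
      using st by (simp add: equiv_L4_1_def)
    show ?thesis
    proof (rule that)
      show "i \<in> set (letters n)" by fact
      show "w = (c @ subst_word \<theta> (s1 i) @ z1) @ i # (z2 @ subst_word \<theta> (s2 i) @ d)"
        unfolding w by (subst s) (simp add: z)
      show "c @ subst_word \<theta> t @ d =
          (c @ subst_word \<theta> t1 @ z1) @ i # (z2 @ subst_word \<theta> t2 @ d)"
        by (simp add: t z)
      show "i \<notin> set (z2 @ subst_word \<theta> (s2 i) @ d)"
        using z i2 inner ik(1) by simp
      have "subst_word \<psi> s = subst_word erase (subst_word \<theta> (s1 i) @ z1) @ GA #
          subst_word erase (z2 @ subst_word \<theta> (s2 i))"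
        by (subst s) (simp add: \<psi>[OF y1] \<psi>[OF y2] \<psi>y)
      moreover have "subst_word \<psi> t = subst_word erase (subst_word \<theta> t1 @ z1) @ GA #
          subst_word erase (z2 @ subst_word \<theta> t2)"
        by (simp add: t(1) \<psi>[OF t(2)] \<psi>[OF t(3)] \<psi>y)
      ultimately show "nf (subst_word erase (c @ subst_word \<theta> (s1 i) @ z1) @ GA #
            subst_word erase (z2 @ subst_word \<theta> (s2 i) @ d)) =
          nf (subst_word erase (c @ subst_word \<theta> t1 @ z1) @ GA #
            subst_word erase (z2 @ subst_word \<theta> t2 @ d))"
        using nf_cong[OF \<psi>_eq, of "subst_word erase c" "subst_word erase d"] by simp
    qed
  qed
qed

text \<open>The property is pulled back from \<open>w'\<close> to \<open>w\<close>: it makes the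
  marked value of \<open>w'\<close> zero, hence that of \<open>w\<close>, where the mark is a last
  occurrence as the converse requires.\<close>

lemma has_insertion_rewr:
  assumes "rewr \<Sigma> w w'" and "has_insertion n w'"
    and \<Sigma>: "\<And>s t. (s, t) \<in> \<Sigma> \<Longrightarrow> equiv_L4_1 s t \<and> length s < n \<and> length t < n"
  shows "has_insertion n w"
  using assms(1)
proof cases
  case (1 s t c \<theta> d)
  then have "equiv_L4_1 s t" "length s < n"
    using \<Sigma> by (auto simp: equiv_L4_1_def)
  then obtain i u v u' v' where i: "i \<in> set (letters n)" "w = u @ i # v" "i \<notin> set v"
      "w' = u' @ i # v'"
      "nf (subst_word erase u @ GA # subst_word erase v) =
        nf (subst_word erase u' @ GA # subst_word erase v')"
    using mark_occurrence[OF 1(1)] 1(2) by metis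
  have "nf (subst_word erase u' @ GA # subst_word erase v') = F0"
    using \<open>has_insertion n w'\<close> i(1,4) by (rule has_insertion_imp_erase_eq_F0)
  with i show ?thesis by (intro erase_eq_F0_imp_has_insertion) auto
qed

end

section \<open>Separation of the two sides and conclusion\<close>

lemma has_insertion_rhs: "has_insertion n (rhs n)"
proof -
  have "rhs n = (rev (letters n) @ [0] @ letters n) @ 0 # [1, 0, 1]"
    by (simp add: rhs_def)
  moreover have "i \<notin> set [1, 0, 1]" if "i \<in> set (letters n)" for i
    using that by (auto simp: letters_def)
  moreover have "subseq [1, 0] [1, 0, 1 :: nat]" by simp
  ultimately show ?thesis unfolding has_insertion_def by blast
qed

text \<open>Marking the last occurrence of the variable \<open>n + 1\<close>, which is z_n, gives bb
  a aba = baba, not zero.\<close>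

lemma not_has_insertion_lhs:
  assumes "0 < n"
  shows "\<not> has_insertion n (lhs n)"
proof
  assume *: "has_insertion n (lhs n)"
  let ?u = "rev (letters n) @ [0, 0] @ [2..<n + 1]"
  have l: "letters n = [2..<n + 1] @ [n + 1]"
    using assms by (simp add: letters_def)
  have e: "subst_word erase [2..<n + 1] = []" "subst_word erase (rev (letters n)) = []"
    by (intro subst_word_empty; auto simp: erase_def letters_def)+
  have "n + 1 \<in> set (letters n)" by (simp add: l)
  moreover have "lhs n = ?u @ (n + 1) # [1, 0, 1]"
    unfolding lhs_def by (subst (2) l) simp
  ultimately have "nf (subst_word erase ?u @ GA # subst_word erase [1, 0, 1]) = F0"
    using * by (intro has_insertion_imp_erase_eq_F0)
  moreover have "subst_word erase ?u = [GB, GB]"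
    by (simp only: map_append concat_append e) (simp add: erase_def)
  moreover have "subst_word erase [1, 0, 1] = [GA, GB, GA]"
    by (simp add: erase_def)
  ultimately have "nf ([GB, GB] @ GA # [GA, GB, GA]) = F0" by (simp only:)
  then show False by simp
qed

lemma not_deducible:
  assumes "finite \<Sigma>" and \<Sigma>: "\<And>s t. (s, t) \<in> \<Sigma> \<Longrightarrow> equiv_L4_1 s t"
  shows "\<exists>n. \<not> deducible V \<Sigma> (lhs n) (rhs n)"
proof -
  have "finite ((\<lambda>(s, t). length s + length t) ` \<Sigma>)"
    using assms(1) by simp
  then obtain n where n: "\<And>s t. (s, t) \<in> \<Sigma> \<Longrightarrow> length s + length t < n"
    unfolding finite_nat_set_iff_bounded by fastforce
  \<comment> \<open>The successor guarantees a z-variable even if \<Sigma> is empty.\<close>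
  let ?n = "Suc n"
  have "\<not> (rewr \<Sigma>)\<^sup>*\<^sup>* (lhs ?n) (rhs ?n)"
  proof
    assume *: "(rewr \<Sigma>)\<^sup>*\<^sup>* (lhs ?n) (rhs ?n)"
    \<comment> \<open>Equivalence to \<open>lhs ?n\<close> is carried along because pulling the
      property back over the next step requires it.\<close>
    have "equiv_L4_1 (lhs ?n) w \<and> (has_insertion ?n w \<longrightarrow> has_insertion ?n (lhs ?n))"
      if "(rewr \<Sigma>)\<^sup>*\<^sup>* (lhs ?n) w" for w
      using that
    proof induction
      case base
      show ?case by (simp add: equiv_L4_1_def)
    next
      case (step w w')
      have "equiv_L4_1 w w'"
        using step.hyps(2) \<Sigma> by (rule rewr_equiv)
      moreover have "has_insertion ?n w" if "has_insertion ?n w'"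
        using step.IH step.hyps(2) that \<Sigma> n by (intro has_insertion_rewr[of ?n w \<Sigma> w']) fastforce+
      ultimately show ?case
        using step.IH by (simp add: equiv_L4_1_def)
    qed
    from this[OF *] show False
      using has_insertion_rhs not_has_insertion_lhs by blast
  qed
  then show ?thesis using deducible_imp_rewr by blast
qed

theorem corollary2p1:
  "\<not> finitely_based_monoid TYPE(L4_1) \<and> \<not> finitely_based_semigroup TYPE(L4_1)"
proof
  show "\<not> finitely_based_monoid TYPE(L4_1)"
  proof
    assume "finitely_based_monoid TYPE(L4_1)"
    then obtain \<Sigma> where \<Sigma>: "finite \<Sigma>" "\<Sigma> \<subseteq> monoid_identities TYPE(L4_1)"
      "\<forall>(u, v) \<in> monoid_identities TYPE(L4_1). deducible UNIV \<Sigma> u v"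
      by (auto simp: finitely_based_monoid_def finitely_axiomatizable_def)
    obtain n where "\<not> deducible UNIV \<Sigma> (lhs n) (rhs n)"
      using not_deducible[OF \<Sigma>(1)] \<Sigma>(2) mem_monoid_identities_iff by blast
    moreover have "(lhs n, rhs n) \<in> monoid_identities TYPE(L4_1)"
      by (simp add: mem_monoid_identities_iff equiv_lhs_rhs)
    ultimately show False using \<Sigma>(3) by blast
  qed
  show "\<not> finitely_based_semigroup TYPE(L4_1)"
  proof
    assume "finitely_based_semigroup TYPE(L4_1)"
    then obtain \<Sigma> where \<Sigma>: "finite \<Sigma>" "\<Sigma> \<subseteq> semigroup_identities TYPE(L4_1)"
      "\<forall>(u, v) \<in> semigroup_identities TYPE(L4_1). deducible {w. w \<noteq> []} \<Sigma> u v"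
      by (auto simp: finitely_based_semigroup_def finitely_axiomatizable_def)
    obtain n where "\<not> deducible {w. w \<noteq> []} \<Sigma> (lhs n) (rhs n)"
      using not_deducible[OF \<Sigma>(1)] \<Sigma>(2) mem_semigroup_identities_iff by blast
    moreover have "(lhs n, rhs n) \<in> semigroup_identities TYPE(L4_1)"
      by (simp add: mem_semigroup_identities_iff equiv_lhs_rhs) (simp add: lhs_def rhs_def)
    ultimately show False using \<Sigma>(3) by blast
  qed
qed

end
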